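(* Let $V$ be a finite set, and let $F\subseteq 2^V\setminus\{\emptyset,V\}$ be a crossing family. Then $F$ admits a cosigning if and only if for every set $U\in F$ there exist an element $u\in U$ and an element $v\in V\setminus U$ such that $V\setminus\{u\}\notin F$ and $\{v\}\notin F$.
   Context: A family $F$ of subsets of $V$ is a crossing family if $U\cap W\in F$ and $U\cup W\in F$ for all $U,W\in F$ with $U\cap W\neq\emptyset$ and $U\cup W\neq V$. A cosigning of a family $F\subseteq 2^V\setminus\{\emptyset,V\}$ is a function $\sigma:V\to\{+,-\}$ such that every $U\in F$ contains an element $u$ with $\sigma(u)=+$ and there is an element $v\in V\setminus U$ with $\sigma(v)=-$. *)

theory Defs
  imports Main
begin

definition crossing_family :: "'a set \<Rightarrow> 'a set set \<Rightarrow> bool" where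
  "crossing_family V F \<longleftrightarrow>
     F \<subseteq> Pow V \<and>
     (\<forall>U\<in>F. \<forall>W\<in>F. U \<inter> W \<noteq> {} \<and> U \<union> W \<noteq> V \<longrightarrow> U \<inter> W \<in> F \<and> U \<union> W \<in> F)"

datatype sign = Plus | Minus

text \<open>A map from \<open>V\<close> to the signs is represented by a total function on the ambient type;
  only its values on \<open>V\<close> matter, since the members of \<open>F\<close> are subsets of \<open>V\<close>.\<close>

definition cosigning :: "'a set \<Rightarrow> 'a set set \<Rightarrow> ('a \<Rightarrow> sign) \<Rightarrow> bool" where
  "cosigning V F \<sigma> \<longleftrightarrow>
     (\<forall>U\<in>F. (\<exists>u\<in>U. \<sigma> u = Plus) \<and> (\<exists>v\<in>V - U. \<sigma> v = Minus))"

end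

theory Submission
  imports Defs
begin

text \<open>
  A member \<open>{v}\<close> of \<open>F\<close> forces the sign \<open>Plus\<close> on \<open>v\<close>, and a member \<open>V - {v}\<close> forces
  \<open>Minus\<close>. The criterion says that these forced signs do no damage on their own: no \<open>U \<in> F\<close>
  consists of forced minus elements, and no complement \<open>V - U\<close> consists of forced plus elements.
  Necessity is immediate. For sufficiency, the undecided elements are signed one at a time, in any
  order, so that the decided elements still do no damage; once all are decided, this
  condition is exactly the definition of a cosigning.

  The process cannot get stuck (\<open>plus_or_minus_extension\<close>): if neither sign is possible for \<open>u\<close>,
  then some \<open>U \<in> F\<close> consists of \<open>u\<close> and minus elements, and some \<open>W \<in> F\<close> has a complement that
  consists of \<open>u\<close> and plus elements. As \<open>u\<close> is not forced, \<open>U\<close> contains a minus element,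
  which lies in \<open>W\<close>, and \<open>V - W\<close> contains a plus element, which lies outside \<open>U\<close>. Thus \<open>U\<close> and
  \<open>W\<close> cross, and \<open>U \<inter> W\<close>, which consists of
  minus elements, belongs to \<open>F\<close>, and the damage was already done before.
\<close>

text \<open>
  \<open>P\<close> and \<open>M\<close> are the elements already decided to be plus and minus. The last two
  conjuncts record the forced signs: without them an undecided \<open>u\<close> could be the only element of
  some \<open>U \<in> F\<close> and of some \<open>V - W\<close> with \<open>W \<in> F\<close>, and then \<open>u\<close> could not be signed at all.
\<close>

definition partial_cosigning :: "'a set \<Rightarrow> 'a set set \<Rightarrow> 'a set \<Rightarrow> 'a set \<Rightarrow> bool" where
  "partial_cosigning V F P M \<longleftrightarrow>
     P \<inter> M = {} \<and>
     (\<forall>U\<in>F. \<not> U \<subseteq> M \<and> \<not> V - U \<subseteq> P) \<and>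
     (\<forall>v. {v} \<in> F \<longrightarrow> v \<in> P) \<and>
     (\<forall>v\<in>V. V - {v} \<in> F \<longrightarrow> v \<in> M)"

lemma plus_or_minus_extension:
  assumes cross: "crossing_family V F"
    and part: "partial_cosigning V F P M"
    and u: "u \<in> V - (P \<union> M)"
  shows "partial_cosigning V F (insert u P) M \<or> partial_cosigning V F P (insert u M)"
proof (rule ccontr)
  assume stuck: "\<not> ?thesis"
  have disj: "P \<inter> M = {}"
    and undamaged: "\<And>U. U \<in> F \<Longrightarrow> \<not> U \<subseteq> M \<and> \<not> V - U \<subseteq> P"
    and free: "{u} \<notin> F" "V - {u} \<notin> F"
    using part u by (auto simp: partial_cosigning_def)
  have "\<exists>W\<in>F. V - W \<subseteq> insert u P"
    using stuck part u unfolding partial_cosigning_def by blast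
  then obtain W where W: "W \<in> F" "V - W \<subseteq> insert u P" by blast
  have "\<exists>U\<in>F. U \<subseteq> insert u M"
    using stuck part u unfolding partial_cosigning_def by blast
  then obtain U where U: "U \<in> F" "U \<subseteq> insert u M" by blast
  have sub: "U \<subseteq> V" "W \<subseteq> V"
    using cross U(1) W(1) by (auto simp: crossing_family_def)
  have mem: "u \<in> U" "u \<notin> W"
    using undamaged[OF U(1)] undamaged[OF W(1)] U(2) W(2) by auto
  have "U \<inter> W \<noteq> {}"
  proof
    assume "U \<inter> W = {}"
    \<comment> \<open>Any other element of \<open>U\<close> is minus, hence not plus, and so it lies in \<open>W\<close>.\<close>
    then have "U = {u}"
      using sub U(2) W(2) disj mem by blast
    then show False using U(1) free by simp
  qed
  moreover have "U \<union> W \<noteq> V"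
  proof
    assume "U \<union> W = V"
    \<comment> \<open>Any other element outside \<open>W\<close> is plus, hence not minus, and so it lies outside \<open>U\<close>.\<close>
    then have "W = V - {u}"
      using sub U(2) W(2) disj mem by blast
    then show False using W(1) free by simp
  qed
  ultimately have "U \<inter> W \<in> F"
    using cross U(1) W(1) by (auto simp: crossing_family_def)
  moreover have "U \<inter> W \<subseteq> M"
    using U(2) mem by blast
  ultimately show False using undamaged by blast
qed

lemma cosigning_if_partial_cosigning:
  assumes fin: "finite V"
    and cross: "crossing_family V F"
    and part: "partial_cosigning V F P M"
  shows "\<exists>\<sigma>. cosigning V F \<sigma>"
  using part
proof (induction "card (V - (P \<union> M))" arbitrary: P M rule: less_induct)
  case less
  show ?case
  proof (cases "V \<subseteq> P \<union> M")
    case True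
    have "cosigning V F (\<lambda>v. if v \<in> P then Plus else Minus)"
      unfolding cosigning_def
    proof
      fix U assume U: "U \<in> F"
      then have "U \<subseteq> V" using cross by (auto simp: crossing_family_def)
      moreover have "\<not> U \<subseteq> M" "\<not> V - U \<subseteq> P"
        using U less.prems by (auto simp: partial_cosigning_def)
      ultimately show "(\<exists>u\<in>U. (if u \<in> P then Plus else Minus) = Plus) \<and>
          (\<exists>v\<in>V - U. (if v \<in> P then Plus else Minus) = Minus)"
        using True by auto
    qed
    then show ?thesis by blast
  next
    case False
    then obtain u where u: "u \<in> V - (P \<union> M)" by blast
    have "card (V - (insert u P \<union> M)) < card (V - (P \<union> M))"
      "card (V - (P \<union> insert u M)) < card (V - (P \<union> M))"
      by (rule psubset_card_mono; use u fin in blast)+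
    then show ?thesis
      using plus_or_minus_extension[OF cross less.prems u] less.hyps by blast
  qed
qed

theorem theorem1p1:
  fixes V :: "'a set" and F :: "'a set set"
  assumes "finite V"
    and "F \<subseteq> Pow V - {{}, V}"
    and "crossing_family V F"
  shows "(\<exists>\<sigma>. cosigning V F \<sigma>) \<longleftrightarrow>
         (\<forall>U\<in>F. \<exists>u\<in>U. \<exists>v\<in>V - U. V - {u} \<notin> F \<and> {v} \<notin> F)"
proof
  assume "\<exists>\<sigma>. cosigning V F \<sigma>"
  then obtain \<sigma> where \<sigma>: "cosigning V F \<sigma>" by blast
  have plus: "\<sigma> v = Plus" if "{v} \<in> F" for v
    using \<sigma> that by (auto simp: cosigning_def)
  have minus: "\<sigma> v = Minus" if "V - {v} \<in> F" for v
    using \<sigma> that by (fastforce simp: cosigning_def)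
  show "\<forall>U\<in>F. \<exists>u\<in>U. \<exists>v\<in>V - U. V - {u} \<notin> F \<and> {v} \<notin> F"
  proof
    fix U assume "U \<in> F"
    then obtain u v where "u \<in> U" "\<sigma> u = Plus" "v \<in> V - U" "\<sigma> v = Minus"
      using \<sigma> by (auto simp: cosigning_def)
    moreover from this have "V - {u} \<notin> F" "{v} \<notin> F"
      using plus minus by (metis sign.distinct(1))+
    ultimately show "\<exists>u\<in>U. \<exists>v\<in>V - U. V - {u} \<notin> F \<and> {v} \<notin> F" by blast
  qed
next
  assume criterion: "\<forall>U\<in>F. \<exists>u\<in>U. \<exists>v\<in>V - U. V - {u} \<notin> F \<and> {v} \<notin> F"
  \<comment> \<open>The two sets of forced elements are disjoint by the criterion for \<open>U = {v}\<close>.\<close>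
  have "partial_cosigning V F {v. {v} \<in> F} {v\<in>V. V - {v} \<in> F}"
    unfolding partial_cosigning_def using criterion by blast
  then show "\<exists>\<sigma>. cosigning V F \<sigma>"
    using cosigning_if_partial_cosigning assms(1,3) by blast
qed

end
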